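(* Let $\beta\le\alpha$ be $1$-factors of the same weight and the same length, where the length is at most $n$. Then $$\pi''_{\alpha,\beta}(t)=\sum_\gamma \mathrm{PM}(\gamma,t),$$ where the index $\gamma$ ranges over the set of $\alpha\diamond\beta$-sequences.
   Context: Standing setting: $\Bbbk$ is a field and $0\ne v\in\Bbbk$ satisfies $[n]!=[1]\cdots[n]\ne0$, where $[k]=\sum_{t=0}^{k-1}v^{k-1-2t}$. A $1$-factor of length $l$ is a sequence $\alpha=(\alpha_1,\dots,\alpha_l)$ with $\alpha_i=\pm1$ and all partial sums $\alpha_1+\cdots+\alpha_i\ge0$. Its weight $i_\alpha$ is the sum of its entries. If $\alpha_i=1$ and $j$ is the smallest index with $i<j\le l$ and $\alpha_i+\cdots+\alpha_j=0$, then $(i,j)$ is a pairing of $\alpha$; unpaired indices are called defects (there are $i_\alpha$ of them). For $1$-factors of equal length, $\beta\le\alpha$ means $\beta_1+\cdots+\beta_j\le\alpha_1+\cdots+\alpha_j$ for every $j$. Write $\alpha^+$ and $\alpha^-$ for the sequences obtained by appending $1$, respectively $-1$, to $\alpha$ ($\alpha^-$ is a $1$-factor only if $i_\alpha>0$). If $i_\alpha>1$ and $1\le j\le i_\alpha-1$, $\alpha^{(j)}$ is the $1$-factor obtained from $\alpha$ by pairing its $j$th defect with the next one (changing the entry of $\alpha$ at the $(j+1)$st defect to $-1$). $\alpha^{+(j)}$ means $(\alpha^+)^{(j)}$, for $1\le j\le i_\alpha$. The polynomials $\pi''_{\alpha,\beta}(t)\in\mathbb N[t_1,t_2,\dots]$,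 for $1$-factors of the same length and weight, are those produced by the following recursion: $\pi''_{\emptyset,\emptyset}=1$; $\pi''_{\alpha^+,\beta^+}=\pi''_{\alpha,\beta}$, and $\pi''_{\alpha^+,\epsilon}=0$ if $\epsilon$ is not of the form $\beta^+$; and, if $i_\alpha>0$, $\pi''_{\alpha^-,\epsilon}=\sum t_j\,\pi''_{\alpha,\beta}$, summed over all pairs $(\beta,j)$ with $\beta$ a $1$-factor of the same length and weight as $\alpha$, $1\le j\le i_\beta$, and $\beta^{+(j)}=\epsilon$. (These satisfy $\mu(\alpha)=\sum_{\beta\le\alpha}\pi''_{\alpha,\beta}([1],[2],\dots)\,\eta(\beta)$ for the two families of maximal vectors $\mu(\alpha)$, $\eta(\beta)$ in the tensor powers of the two-dimensional space $V$ with basis $y_1,y_{-1}$ defined as follows. $F$ acts on $V^{\otimes m}$ as $\sum_{j=1}^m1^{\otimes(j-1)}\otimes F\otimes(K^{-1})^{\otimes(m-j)}$ with $Fy_1=y_{-1}$, $Fy_{-1}=0$, $Ky_{\pm1}=v^{\pm1}y_{\pm1}$; $\mu(\emptyset)=1$, $\mu(\alpha^+)=\mu(\alpha)\otimes y_1$, $\mu(\alpha^-)=[i_\alpha]\mu(\alpha)\otimes y_{-1}-v^{i_\alpha}F\mu(\alpha)\otimes y_1$. And $\eta(\emptyset)=1$; if index $1$ is a defect, $\eta(\alpha)=y_1\otimes\eta(\alpha_2,\dots,\alpha_l)$; if $1$ is paired with $j$, $\eta(\alpha)=\Psi(\eta(\alpha_2,\dots,\alpha_{j-1}))\otimes\eta(\alpha_{j+1},\dots,\alpha_l)$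 with $\Psi(b)=y_1\otimes b\otimes y_{-1}-v\,y_{-1}\otimes b\otimes y_1$.) For $1$-factors $\gamma,\beta$ (not necessarily of the same length), $\gamma\subseteq\beta$ means that for every pairing in $\gamma$ there is a pairing in $\beta$ in the same positions. For $1$-factors $\alpha,\beta$ of the same weight and length $l$, an $\alpha\diamond\beta$-sequence is a sequence $\gamma=(\gamma(0),\gamma(1),\dots,\gamma(l))$ of $1$-factors such that: (i) $\gamma(k)$ has length $k$ for all $k$; (ii) $\gamma(k)=\gamma(k-1)^+$ if $\alpha_k=1$; (iii) $\gamma(k)=\gamma(k-1)^{+(j)}$ for some $j$ if $\alpha_k=-1$; (iv) $\gamma(k)\subseteq\beta$ for all $k$. For each $k$ with $\alpha_k=-1$, the pairing variable is $t_j$, where $\gamma(k)=\gamma(k-1)^{+(j)}$. The pairing monomial $\mathrm{PM}(\gamma,t)$ is the product of all pairing variables of $\gamma$. *)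

theory Defs
  imports Complex_Main "HOL-Library.Poly_Mapping"
begin

section \<open>Quantum integers\<close>

definition qint :: "'k::field \<Rightarrow> nat \<Rightarrow> 'k" where
  "qint v k = (\<Sum>t<k. v powi (int k - 1 - 2 * int t))"

definition qfact :: "'k::field \<Rightarrow> nat \<Rightarrow> 'k" where
  "qfact v n = (\<Prod>k=1..n. qint v k)"


section \<open>1-factors\<close>

text \<open>
  A sequence is a list of integers. Positions are list indices, so position \<open>i\<close> of the
  mathematical notation is index \<open>i - 1\<close> here; the numbering of the defects of a sequence
  (first, second, ...) starts at 1.
\<close>

definition one_factor :: "int list \<Rightarrow> bool" where
  "one_factor \<alpha> \<longleftrightarrow>
     (\<forall>a\<in>set \<alpha>. a = 1 \<or> a = -1) \<and> (\<forall>k\<le>length \<alpha>. sum_list (take k \<alpha>) \<ge> 0)"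

definition weight :: "int list \<Rightarrow> int" where
  "weight \<alpha> = sum_list \<alpha>"

definition dominated :: "int list \<Rightarrow> int list \<Rightarrow> bool" where
  "dominated \<beta> \<alpha> \<longleftrightarrow> length \<beta> = length \<alpha> \<and>
     (\<forall>k\<le>length \<alpha>. sum_list (take k \<beta>) \<le> sum_list (take k \<alpha>))"

definition pairing :: "int list \<Rightarrow> nat \<Rightarrow> nat \<Rightarrow> bool" where
  "pairing \<alpha> i j \<longleftrightarrow> i < j \<and> j < length \<alpha> \<and> \<alpha> ! i = 1 \<and>
     (\<Sum>m=i..j. \<alpha> ! m) = 0 \<and> (\<forall>j'. i < j' \<and> j' < j \<longrightarrow> (\<Sum>m=i..j'. \<alpha> ! m) \<noteq> 0)"

definition defect :: "int list \<Rightarrow> nat \<Rightarrow> bool" where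
  "defect \<alpha> i \<longleftrightarrow> i < length \<alpha> \<and> (\<nexists>j. pairing \<alpha> i j \<or> pairing \<alpha> j i)"

definition defects :: "int list \<Rightarrow> nat list" where
  "defects \<alpha> = filter (defect \<alpha>) [0..<length \<alpha>]"

text \<open>
  The sequence \<open>\<alpha>\<close> with its \<open>j\<close>th defect paired with the next one, meaningful for
  \<open>1 \<le> j \<le> weight \<alpha> - 1\<close>. As list indices start at 0, \<open>defects \<alpha> ! j\<close> is the
  \<open>(j+1)\<close>st defect.
\<close>

definition pair_defect :: "int list \<Rightarrow> nat \<Rightarrow> int list" where
  "pair_defect \<alpha> j = \<alpha>[defects \<alpha> ! j := -1]"

text \<open>\<open>\<epsilon>\<close> is \<open>\<beta>\<^sup>+\<^sup>(\<^sup>j\<^sup>)\<close>, including the condition that the latter is defined.\<close>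

definition plus_paired :: "int list \<Rightarrow> nat \<Rightarrow> int list \<Rightarrow> bool" where
  "plus_paired \<beta> j \<epsilon> \<longleftrightarrow> 1 \<le> j \<and> int j \<le> weight \<beta> \<and> \<epsilon> = pair_defect (\<beta> @ [1]) j"

definition contained :: "int list \<Rightarrow> int list \<Rightarrow> bool" where
  "contained \<gamma> \<beta> \<longleftrightarrow> (\<forall>i j. pairing \<gamma> i j \<longrightarrow> pairing \<beta> i j)"


section \<open>The polynomials\<close>

text \<open>
  Polynomials with natural coefficients in variables indexed by natural numbers: finitely
  supported maps from exponent vectors to coefficients, with convolution as product. The
  variable with index 0 is never used.
\<close>

type_synonym npoly = "(nat \<Rightarrow>\<^sub>0 nat) \<Rightarrow>\<^sub>0 nat"

definition tvar :: "nat \<Rightarrow> npoly" where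
  "tvar j = Poly_Mapping.single (Poly_Mapping.single j 1) 1"

text \<open>
  The recursion removes the last entry of the first argument. The values matter only for
  1-factors of the same length and weight; the recursion equations in their usual form are
  proved below.
\<close>

definition predecessors :: "int list \<Rightarrow> int list \<Rightarrow> (int list \<times> nat) set" where
  "predecessors \<alpha> \<epsilon> = {(\<beta>, j). one_factor \<beta> \<and> length \<beta> = length \<alpha> \<and>
     weight \<beta> = weight \<alpha> \<and> plus_paired \<beta> j \<epsilon>}"

function pi2 :: "int list \<Rightarrow> int list \<Rightarrow> npoly" where
  "pi2 \<alpha> \<epsilon> =
     (if \<alpha> = [] then (if \<epsilon> = [] then 1 else 0)
      else if last \<alpha> = 1 then
        (if \<epsilon> \<noteq> [] \<and> last \<epsilon> = 1 then pi2 (butlast \<alpha>) (butlast \<epsilon>) else 0)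
      else (\<Sum>(\<beta>, j)\<in>predecessors (butlast \<alpha>) \<epsilon>. tvar j * pi2 (butlast \<alpha>) \<beta>))"
  by pat_completeness auto
termination
  by (relation "measure (\<lambda>(\<alpha>, \<epsilon>). length \<alpha>)") auto

declare pi2.simps [simp del]

lemma pi2_Nil: "pi2 [] [] = 1"
  by (simp add: pi2.simps)

lemma pi2_plus: "pi2 (\<alpha> @ [1]) (\<beta> @ [1]) = pi2 \<alpha> \<beta>"
  by (subst pi2.simps) simp

lemma pi2_plus_0: "(\<And>\<beta>. \<epsilon> \<noteq> \<beta> @ [1]) \<Longrightarrow> pi2 (\<alpha> @ [1]) \<epsilon> = 0"
  by (subst pi2.simps) (auto, metis append_butlast_last_id)

lemma pi2_minus:
  "pi2 (\<alpha> @ [-1]) \<epsilon> = (\<Sum>(\<beta>, j)\<in>predecessors \<alpha> \<epsilon>. tvar j * pi2 \<alpha> \<beta>)"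
  by (subst pi2.simps) simp

lemma finite_predecessors: "finite (predecessors \<alpha> \<epsilon>)"
proof (rule finite_subset)
  show "predecessors \<alpha> \<epsilon> \<subseteq>
      {\<beta>. set \<beta> \<subseteq> {1, -1} \<and> length \<beta> = length \<alpha>} \<times> {..nat (weight \<alpha>)}"
    by (auto simp: predecessors_def one_factor_def plus_paired_def)
  show "finite ({\<beta>. set \<beta> \<subseteq> {1, -1::int} \<and> length \<beta> = length \<alpha>} \<times> {..nat (weight \<alpha>)})"
    by (intro finite_cartesian_product finite_lists_length_eq) auto
qed


section \<open>Diamond sequences and pairing monomials\<close>

text \<open>
  A sequence \<open>(\<gamma>(0), \<dots>, \<gamma>(l))\<close> is a list of length \<open>l + 1\<close>, with \<open>\<gamma>(k)\<close> the entry
  \<open>\<gamma> ! k\<close>. The step from \<open>\<gamma> ! k\<close> to \<open>\<gamma> ! Suc k\<close> is governed by the entry \<open>\<alpha> ! k\<close>,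
  which is the \<open>(k+1)\<close>st one.
\<close>

definition diamond_seqs :: "int list \<Rightarrow> int list \<Rightarrow> int list list set" where
  "diamond_seqs \<alpha> \<beta> = {\<gamma>. length \<gamma> = Suc (length \<alpha>) \<and>
     (\<forall>k\<le>length \<alpha>. one_factor (\<gamma> ! k) \<and> length (\<gamma> ! k) = k) \<and>
     (\<forall>k<length \<alpha>. \<alpha> ! k = 1 \<longrightarrow> \<gamma> ! Suc k = (\<gamma> ! k) @ [1]) \<and>
     (\<forall>k<length \<alpha>. \<alpha> ! k = -1 \<longrightarrow> (\<exists>j. plus_paired (\<gamma> ! k) j (\<gamma> ! Suc k))) \<and>
     (\<forall>k\<le>length \<alpha>. contained (\<gamma> ! k) \<beta>)}"

text \<open>
  The index \<open>j\<close> of a pairing variable is unique, because it determines the position at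
  which the entry is changed.
\<close>

definition pairing_var :: "int list list \<Rightarrow> nat \<Rightarrow> npoly" where
  "pairing_var \<gamma> k = tvar (THE j. plus_paired (\<gamma> ! k) j (\<gamma> ! Suc k))"

definition pairing_monomial :: "int list \<Rightarrow> int list list \<Rightarrow> npoly" where
  "pairing_monomial \<alpha> \<gamma> = (\<Prod>k\<in>{k. k < length \<alpha> \<and> \<alpha> ! k = -1}. pairing_var \<gamma> k)"

lemma finite_diamond_seqs: "finite (diamond_seqs \<alpha> \<beta>)"
proof (rule finite_subset)
  let ?L = "{x :: int list. set x \<subseteq> {1, -1} \<and> length x \<le> length \<alpha>}"
  show "diamond_seqs \<alpha> \<beta> \<subseteq> {\<gamma>. set \<gamma> \<subseteq> ?L \<and> length \<gamma> = Suc (length \<alpha>)}"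
    by (fastforce simp: diamond_seqs_def one_factor_def in_set_conv_nth less_Suc_eq_le)
  show "finite {\<gamma>. set \<gamma> \<subseteq> ?L \<and> length \<gamma> = Suc (length \<alpha>)}"
    by (intro finite_lists_length_eq finite_lists_length_le) auto
qed

end

theory Submission
  imports Defs
begin

text \<open>
  Unrolling the recursion for \<open>pi2 \<alpha> \<beta>\<close> from the last entry of \<open>\<alpha>\<close> to the first produces one
  monomial for every way of building \<open>\<beta>\<close> from the empty sequence in \<open>length \<alpha>\<close> steps, where the
  \<open>k\<close>th step is \<open>\<gamma> \<mapsto> \<gamma>\<^sup>+\<close> if the \<open>k\<close>th entry of \<open>\<alpha>\<close> is \<open>1\<close>, and \<open>\<gamma> \<mapsto> \<gamma>\<^sup>+\<^sup>(\<^sup>j\<^sup>)\<close> for some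
  \<open>j\<close>, at the price of a factor \<open>t\<^sub>j\<close>, if it is \<open>-1\<close> (\<open>pi2_eq_sum_growth_seqs\<close>).  These
  constructions differ from the diamond sequences only in how the target \<open>\<beta>\<close> is imposed: they ask
  that the last term be \<open>\<beta>\<close>, whereas a diamond sequence has all its terms contained in \<open>\<beta>\<close>.

  The two conditions agree (\<open>diamond_seqs_eq_growth_seqs\<close>).  On the one hand, a step never destroys
  a pairing, since no pairing straddles a defect; so every term is contained in the last one
  (\<open>contained_plus_paired\<close>).  On the other hand, the steps force the last term to have the weight of
  \<open>\<alpha>\<close>, which is that of \<open>\<beta>\<close>; and containment between 1-factors of equal length and weight is
  equality, because the entries \<open>-1\<close> of a 1-factor are exactly the right ends of its pairings
  (\<open>contained_imp_eq\<close>).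

  All facts about pairings are read off the lattice path of partial sums: a pairing is an upward
  step together with the first return to the height below it, and a defect of a 1-factor is an
  upward step to whose starting height the path never returns.
\<close>

section \<open>Pairings and defects in terms of partial sums\<close>

abbreviation height :: "int list \<Rightarrow> nat \<Rightarrow> int" where
  "height \<alpha> k \<equiv> sum_list (take k \<alpha>)"

lemma height_Suc: "k < length \<alpha> \<Longrightarrow> height \<alpha> (Suc k) = height \<alpha> k + \<alpha> ! k"
  by (simp add: take_Suc_conv_app_nth)

lemma sum_segment_eq_height_diff:
  assumes "i \<le> j" and "j < length \<alpha>"
  shows "(\<Sum>m=i..j. \<alpha> ! m) = height \<alpha> (Suc j) - height \<alpha> i"
  using assms
proof (induction j rule: dec_induct)
  case base
  then show ?case by (simp add: height_Suc)
next
  case (step j)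
  then show ?case by (simp add: height_Suc)
qed

lemma pm_one_nth: "\<lbrakk>set \<alpha> \<subseteq> {1, -1::int}; k < length \<alpha>\<rbrakk> \<Longrightarrow> \<alpha> ! k = 1 \<or> \<alpha> ! k = -1"
  using nth_mem by blast

lemma one_factor_pm_one: "one_factor \<alpha> \<Longrightarrow> set \<alpha> \<subseteq> {1, -1}"
  by (auto simp: one_factor_def)

lemma one_factor_height_nonneg: "\<lbrakk>one_factor \<alpha>; k \<le> length \<alpha>\<rbrakk> \<Longrightarrow> 0 \<le> height \<alpha> k"
  by (simp add: one_factor_def)

lemma one_factor_butlast: "one_factor (\<alpha> @ [a]) \<Longrightarrow> one_factor \<alpha>"
  unfolding one_factor_def by (auto simp: le_Suc_eq)

lemma one_factor_append_one:
  assumes "one_factor \<alpha>"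
  shows "one_factor (\<alpha> @ [1])"
  using assms one_factor_height_nonneg[OF assms, of "length \<alpha>"]
  by (auto simp: one_factor_def le_Suc_eq)

text \<open>
  A path with steps \<open>1\<close> and \<open>-1\<close> cannot get below its starting height without passing through it,
  so before the first return it stays strictly above.
\<close>

lemma height_above_inside_pairing:
  assumes pm: "set \<alpha> \<subseteq> {1, -1}" and p: "pairing \<alpha> i j" and "i < m" and "m \<le> j"
  shows "height \<alpha> i < height \<alpha> m"
  using \<open>i < m\<close>[folded Suc_le_eq] \<open>m \<le> j\<close>
proof (induction m rule: dec_induct)
  case base
  then show ?case using p by (simp add: pairing_def height_Suc)
next
  case (step m)
  have "m < length \<alpha>" "i < m" "m < j" using step p by (auto simp: pairing_def)
  then have "height \<alpha> (Suc m) \<noteq> height \<alpha> i"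
    using p sum_segment_eq_height_diff[of i m \<alpha>] by (auto simp: pairing_def)
  moreover have "height \<alpha> (Suc m) \<ge> height \<alpha> m - 1"
    using pm_one_nth[OF pm \<open>m < length \<alpha>\<close>] height_Suc[OF \<open>m < length \<alpha>\<close>] by auto
  ultimately show ?case using step by simp
qed

lemma height_after_pairing: "pairing \<alpha> i j \<Longrightarrow> height \<alpha> (Suc j) = height \<alpha> i"
  using sum_segment_eq_height_diff[of i j \<alpha>] by (simp add: pairing_def)

lemma pairing_right_end:
  assumes "set \<alpha> \<subseteq> {1, -1}" and "pairing \<alpha> i j"
  shows "\<alpha> ! j = -1"
proof -
  have "i < j" "j < length \<alpha>" using assms(2) by (auto simp: pairing_def)
  then show ?thesis
    using height_above_inside_pairing[OF assms, of j] height_after_pairing[OF assms(2)]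
      height_Suc[of j \<alpha>] pm_one_nth[OF assms(1), of j] by auto
qed

lemma pairingI:
  assumes "i < j" "j < length \<alpha>" "\<alpha> ! i = 1" "height \<alpha> (Suc j) = height \<alpha> i"
    and "\<And>m. i < m \<Longrightarrow> m \<le> j \<Longrightarrow> height \<alpha> i < height \<alpha> m"
  shows "pairing \<alpha> i j"
proof -
  have "(\<Sum>m=i..j'. \<alpha> ! m) \<noteq> 0" if "i < j'" "j' < j" for j'
    using that assms(2) assms(5)[of "Suc j'"] sum_segment_eq_height_diff[of i j' \<alpha>] by simp
  then show ?thesis
    using assms(1-4) sum_segment_eq_height_diff[of i j \<alpha>] by (auto simp: pairing_def)
qed

lemma pairing_cong:
  assumes p: "pairing \<alpha> i j" and "j < length \<alpha>'"
    and eq: "\<And>m. i \<le> m \<Longrightarrow> m \<le> j \<Longrightarrow> \<alpha>' ! m = \<alpha> ! m"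
  shows "pairing \<alpha>' i j"
proof -
  have "(\<Sum>m=i..j'. \<alpha>' ! m) = (\<Sum>m=i..j'. \<alpha> ! m)" if "j' \<le> j" for j'
    using that eq by (intro sum.cong) auto
  then show ?thesis using p assms(2) eq[of i] by (simp add: pairing_def)
qed

lemma paired_or_stays_above:
  assumes pm: "set \<alpha> \<subseteq> {1, -1}" and "i < length \<alpha>" and "\<alpha> ! i = 1"
  shows "(\<exists>j. pairing \<alpha> i j) \<or> (\<forall>m. i < m \<and> m \<le> length \<alpha> \<longrightarrow> height \<alpha> i < height \<alpha> m)"
proof (rule disjCI)
  let ?P = "\<lambda>m. i < m \<and> m \<le> length \<alpha> \<and> height \<alpha> m \<le> height \<alpha> i"
  assume "\<not> (\<forall>m. i < m \<and> m \<le> length \<alpha> \<longrightarrow> height \<alpha> i < height \<alpha> m)"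
  then have "\<exists>m. ?P m" by auto
  define m where "m = (LEAST m. ?P m)"
  have m: "?P m" unfolding m_def by (rule LeastI_ex) fact
  have least: "height \<alpha> i < height \<alpha> m'" if "i < m'" "m' < m" for m'
    using not_less_Least[of m' ?P] that m by (force simp: m_def)
  obtain j where j: "m = Suc j" using m by (cases m) auto
  have "j \<noteq> i" using m j height_Suc[OF assms(2)] assms(3) by auto
  then have ij: "i < j" "j < length \<alpha>" using m j by auto
  have "height \<alpha> (Suc j) = height \<alpha> i"
    using least[of j] ij m j height_Suc[of j \<alpha>] pm_one_nth[OF pm, of j] by auto
  then show "\<exists>j. pairing \<alpha> i j"
    using ij least j assms(3) by (intro exI[of _ j] pairingI) auto
qed

text \<open>
  The partner of a downward step starts where the path is, for the last time before that step, as
  low as it is after it. Such a place exists because the path starts at height \<open>0\<close>.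
\<close>

lemma minus_one_paired:
  assumes of: "one_factor \<alpha>" and j: "j < length \<alpha>" and "\<alpha> ! j = -1"
  shows "\<exists>i. pairing \<alpha> i j"
proof -
  let ?P = "\<lambda>m. m \<le> j \<and> height \<alpha> m \<le> height \<alpha> (Suc j)"
  have "?P 0" using one_factor_height_nonneg[OF of, of "Suc j"] j by simp
  define i where "i = (GREATEST m. ?P m)"
  have i: "?P i" unfolding i_def by (rule GreatestI_nat[of ?P 0 j]) (use \<open>?P 0\<close> in auto)
  have above: "height \<alpha> (Suc j) < height \<alpha> m" if "i < m" "m \<le> j" for m
    using Greatest_le_nat[of ?P m j] that by (force simp: i_def)
  have "i \<noteq> j" using i height_Suc[OF j] assms(3) by auto
  then have "i < j" using i by simp
  moreover have "height \<alpha> (Suc j) < height \<alpha> (Suc i)" using above[of "Suc i"] \<open>i < j\<close> by simp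
  moreover have "\<alpha> ! i = 1 \<or> \<alpha> ! i = -1"
    using pm_one_nth[OF one_factor_pm_one[OF of], of i] \<open>i < j\<close> j by simp
  ultimately have "\<alpha> ! i = 1" "height \<alpha> (Suc j) = height \<alpha> i"
    using i height_Suc[of i \<alpha>] j by auto
  then show ?thesis using above \<open>i < j\<close> j by (intro exI[of _ i] pairingI) auto
qed

lemma defect_entry: "\<lbrakk>one_factor \<alpha>; defect \<alpha> p\<rbrakk> \<Longrightarrow> \<alpha> ! p = 1"
  using minus_one_paired[of \<alpha> p] pm_one_nth[OF one_factor_pm_one, of \<alpha> p]
  by (auto simp: defect_def)

lemma height_above_after_defect:
  assumes "one_factor \<alpha>" and "defect \<alpha> p" and "p < m" and "m \<le> length \<alpha>"
  shows "height \<alpha> p < height \<alpha> m"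
  using paired_or_stays_above[OF one_factor_pm_one[OF assms(1)], of p]
    defect_entry[OF assms(1,2)] assms by (auto simp: defect_def)

lemma defectI:
  assumes pm: "set \<alpha> \<subseteq> {1, -1}" and "p < length \<alpha>" and "\<alpha> ! p = 1"
    and above: "\<And>m. p < m \<Longrightarrow> m \<le> length \<alpha> \<Longrightarrow> height \<alpha> p < height \<alpha> m"
  shows "defect \<alpha> p"
proof -
  have "\<not> pairing \<alpha> p j" for j
  proof
    assume p: "pairing \<alpha> p j"
    then have "p < Suc j" "Suc j \<le> length \<alpha>" by (auto simp: pairing_def)
    then show False using above[of "Suc j"] height_after_pairing[OF p] by simp
  qed
  moreover have "\<not> pairing \<alpha> j p" for j
    using pairing_right_end[OF pm, of j p] assms(3) by auto
  ultimately show ?thesis using assms(2) by (auto simp: defect_def)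
qed

lemma pairing_not_across_defect:
  assumes of: "one_factor \<alpha>" and d: "defect \<alpha> p" and p: "pairing \<alpha> i j"
  shows "p < i \<or> j < p"
proof (rule ccontr)
  assume "\<not> (p < i \<or> j < p)"
  moreover have "p \<noteq> i" "p \<noteq> j" using d p by (auto simp: defect_def)
  ultimately have "i < p" "p < j" by auto
  then have "height \<alpha> i < height \<alpha> p"
    using height_above_inside_pairing[OF one_factor_pm_one[OF of] p] by simp
  also have "\<dots> < height \<alpha> (Suc j)"
    using height_above_after_defect[OF of d, of "Suc j"] \<open>p < j\<close> p by (simp add: pairing_def)
  finally show False using height_after_pairing[OF p] by simp
qed

text \<open>
  For every height \<open>c\<close> below the final one, the step at the last visit to a height \<open>\<le> c\<close> is a
  defect that starts at height \<open>c\<close>. Hence there are enough defects for \<open>\<beta>\<^sup>+\<^sup>(\<^sup>j\<^sup>)\<close> to refer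
  to an actual defect of \<open>\<beta>\<^sup>+\<close>.
\<close>

lemma weight_le_length_defects:
  assumes of: "one_factor \<alpha>"
  shows "weight \<alpha> \<le> int (length (defects \<alpha>))"
proof -
  have "{0..<weight \<alpha>} \<subseteq> height \<alpha> ` set (defects \<alpha>)"
  proof
    fix c assume c: "c \<in> {0..<weight \<alpha>}"
    let ?P = "\<lambda>m. m \<le> length \<alpha> \<and> height \<alpha> m \<le> c"
    define p where "p = (GREATEST m. ?P m)"
    have p: "?P p"
      unfolding p_def by (rule GreatestI_nat[of ?P 0 "length \<alpha>"]) (use c in auto)
    have above: "c < height \<alpha> m" if "p < m" "m \<le> length \<alpha>" for m
      using Greatest_le_nat[of ?P m "length \<alpha>"] that by (force simp: p_def)
    have "p \<noteq> length \<alpha>" using p c by (auto simp: weight_def)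
    then have pl: "p < length \<alpha>" using p by simp
    then have "c < height \<alpha> (Suc p)" using above by simp
    then have "\<alpha> ! p = 1" "height \<alpha> p = c"
      using p height_Suc[OF pl] pm_one_nth[OF one_factor_pm_one[OF of] pl] by auto
    moreover from this have "defect \<alpha> p"
      using defectI[OF one_factor_pm_one[OF of] pl] above by simp
    ultimately show "c \<in> height \<alpha> ` set (defects \<alpha>)"
      using pl by (auto simp: defects_def)
  qed
  then have "card {0..<weight \<alpha>} \<le> card (height \<alpha> ` set (defects \<alpha>))"
    by (intro card_mono) auto
  also have "\<dots> \<le> card (set (defects \<alpha>))" by (intro card_image_le) simp
  also have "\<dots> \<le> length (defects \<alpha>)" by (rule card_length)
  finally show ?thesis by simp
qed

text \<open>
  Containment makes \<open>\<gamma>\<close> dominate \<open>\<beta>\<close> entry by entry, as \<open>\<beta>\<close> has an entry \<open>-1\<close> wherever \<open>\<gamma>\<close>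
  does; the equality of the entry sums then leaves no room.
\<close>

lemma contained_imp_eq:
  assumes "one_factor \<gamma>" and "one_factor \<beta>" and len: "length \<gamma> = length \<beta>"
    and w: "weight \<gamma> = weight \<beta>" and c: "contained \<gamma> \<beta>"
  shows "\<gamma> = \<beta>"
proof -
  have le: "\<beta> ! k \<le> \<gamma> ! k" if k: "k < length \<beta>" for k
  proof (cases "\<gamma> ! k = -1")
    case True
    then obtain i where "pairing \<gamma> i k" using minus_one_paired[OF assms(1)] k len by auto
    then have "pairing \<beta> i k" using c by (simp add: contained_def)
    then show ?thesis
      using True pairing_right_end[OF one_factor_pm_one[OF assms(2)]] by simp
  next
    case False
    then show ?thesis
      using k len pm_one_nth[OF one_factor_pm_one[OF assms(1)], of k]
        pm_one_nth[OF one_factor_pm_one[OF assms(2)], of k] by auto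
  qed
  have "(\<Sum>k<length \<beta>. \<gamma> ! k - \<beta> ! k) = 0"
    using w len by (simp add: weight_def sum_list_sum_nth sum_subtractf atLeast0LessThan)
  then have "\<forall>k<length \<beta>. \<gamma> ! k - \<beta> ! k = 0"
    using le by (subst (asm) sum_nonneg_eq_0_iff) auto
  then show ?thesis using len by (intro nth_equalityI) auto
qed

lemma contained_refl: "contained \<beta> \<beta>"
  by (simp add: contained_def)

lemma contained_trans: "\<lbrakk>contained \<alpha> \<beta>; contained \<beta> \<gamma>\<rbrakk> \<Longrightarrow> contained \<alpha> \<gamma>"
  by (simp add: contained_def)

lemma contained_append: "contained \<delta> (\<delta> @ [a])"
  unfolding contained_def
proof (intro allI impI)
  fix i j assume p: "pairing \<delta> i j"
  then show "pairing (\<delta> @ [a]) i j"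
    by (rule pairing_cong) (use p in \<open>auto simp: pairing_def nth_append\<close>)
qed


section \<open>Appending a one and pairing two defects\<close>

lemma plus_paired_defect:
  assumes "one_factor \<delta>" and "plus_paired \<delta> j \<epsilon>"
  shows "j < length (defects (\<delta> @ [1]))" and "defect (\<delta> @ [1]) (defects (\<delta> @ [1]) ! j)"
proof -
  show *: "j < length (defects (\<delta> @ [1]))"
    using weight_le_length_defects[OF one_factor_append_one[OF assms(1)]] assms(2)
    by (auto simp: plus_paired_def weight_def)
  have "\<forall>p \<in> set (defects (\<delta> @ [1])). defect (\<delta> @ [1]) p" unfolding defects_def by auto
  then show "defect (\<delta> @ [1]) (defects (\<delta> @ [1]) ! j)" using * nth_mem by blast
qed

lemma contained_plus_paired:
  assumes of: "one_factor \<delta>" and pp: "plus_paired \<delta> j \<epsilon>"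
  shows "contained \<delta> \<epsilon>"
proof -
  let ?p = "defects (\<delta> @ [1]) ! j"
  have eps: "\<epsilon> = (\<delta> @ [1])[?p := -1]" using pp by (simp add: plus_paired_def pair_defect_def)
  have "contained (\<delta> @ [1]) \<epsilon>"
    unfolding contained_def
  proof (intro allI impI)
    fix i k assume p: "pairing (\<delta> @ [1]) i k"
    then have "?p < i \<or> k < ?p"
      using pairing_not_across_defect[OF one_factor_append_one[OF of] plus_paired_defect(2)[OF of pp]]
      by blast
    then show "pairing \<epsilon> i k"
      by (intro pairing_cong[OF p]) (use p in \<open>auto simp: eps pairing_def\<close>)
  qed
  then show ?thesis using contained_append contained_trans by blast
qed

lemma sum_list_list_update:
  fixes xs :: "'a::ab_group_add list"
  shows "k < length xs \<Longrightarrow> sum_list (xs[k := x]) = sum_list xs + x - xs ! k"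
  by (induction xs arbitrary: k) (auto simp: algebra_simps split: nat.split)

lemma weight_plus_paired:
  assumes of: "one_factor \<delta>" and pp: "plus_paired \<delta> j \<epsilon>"
  shows "weight \<epsilon> = weight \<delta> - 1"
proof -
  let ?p = "defects (\<delta> @ [1]) ! j"
  note d = plus_paired_defect(2)[OF of pp]
  have p: "?p < length (\<delta> @ [1])" "(\<delta> @ [1]) ! ?p = 1"
    using d defect_entry[OF one_factor_append_one[OF of] d] by (auto simp: defect_def)
  have "sum_list ((\<delta> @ [1])[?p := -1]) = sum_list (\<delta> @ [1]) - 2"
    using sum_list_list_update[OF p(1), of "-1"] p(2) by simp
  then show ?thesis using pp by (simp add: plus_paired_def pair_defect_def weight_def)
qed

text \<open>The position of the changed entry determines \<open>j\<close>, as the list of defects is distinct.\<close>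

lemma plus_paired_unique:
  assumes of: "one_factor \<delta>" and "plus_paired \<delta> j \<epsilon>" and "plus_paired \<delta> j' \<epsilon>"
  shows "j = j'"
proof -
  let ?D = "defects (\<delta> @ [1])"
  note of1 = one_factor_append_one[OF of]
  note d = plus_paired_defect[OF of assms(2)] and d' = plus_paired_defect[OF of assms(3)]
  have eq: "(\<delta> @ [1])[?D ! j := -1] = (\<delta> @ [1])[?D ! j' := -1]"
    using assms(2,3) by (simp add: plus_paired_def pair_defect_def)
  have "(\<delta> @ [1]) ! (?D ! j) = 1" "?D ! j < length (\<delta> @ [1])"
    using d(2) defect_entry[OF of1 d(2)] by (auto simp: defect_def)
  then have "?D ! j = ?D ! j'"
    using arg_cong[OF eq, of "\<lambda>xs. xs ! (?D ! j)"] by (cases "?D ! j = ?D ! j'") auto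
  then show ?thesis using d(1) d'(1) by (simp add: nth_eq_iff_index_eq defects_def)
qed


section \<open>Sequences of 1-factors with prescribed last term\<close>

text \<open>
  Unlike the diamond sequences, in which \<open>\<beta>\<close> bounds every term, these are compatible with the
  removal of the last term, and hence with the recursion.
\<close>

definition growth_seqs :: "int list \<Rightarrow> int list \<Rightarrow> int list list set" where
  "growth_seqs \<alpha> \<epsilon> = {\<gamma>. length \<gamma> = Suc (length \<alpha>) \<and>
     (\<forall>k\<le>length \<alpha>. one_factor (\<gamma> ! k) \<and> length (\<gamma> ! k) = k) \<and>
     (\<forall>k<length \<alpha>. \<alpha> ! k = 1 \<longrightarrow> \<gamma> ! Suc k = (\<gamma> ! k) @ [1]) \<and>
     (\<forall>k<length \<alpha>. \<alpha> ! k = -1 \<longrightarrow> (\<exists>j. plus_paired (\<gamma> ! k) j (\<gamma> ! Suc k))) \<and>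
     \<gamma> ! length \<alpha> = \<epsilon>}"

lemma growth_seqs_last:
  assumes "\<gamma> \<in> growth_seqs \<alpha> \<delta>"
  shows "length \<gamma> = Suc (length \<alpha>)" "\<gamma> ! length \<alpha> = \<delta>" "one_factor \<delta>" "length \<delta> = length \<alpha>"
  using assms by (auto simp: growth_seqs_def)

lemma growth_seqs_Nil: "growth_seqs [] [] = {[[]]}"
  by (auto simp: growth_seqs_def one_factor_def length_Suc_conv)

lemma growth_seqs_snocI:
  assumes \<gamma>: "\<gamma> \<in> growth_seqs \<alpha> \<delta>" and "one_factor \<epsilon>" "length \<epsilon> = Suc (length \<alpha>)"
    and "a = 1 \<Longrightarrow> \<epsilon> = \<delta> @ [1]" and "a = -1 \<Longrightarrow> \<exists>j. plus_paired \<delta> j \<epsilon>"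
  shows "\<gamma> @ [\<epsilon>] \<in> growth_seqs (\<alpha> @ [a]) \<epsilon>"
  using assms unfolding growth_seqs_def by (auto simp: nth_append le_Suc_eq less_Suc_eq)

lemma growth_seqs_snocE:
  assumes \<gamma>': "\<gamma>' \<in> growth_seqs (\<alpha> @ [a]) \<epsilon>"
  obtains \<gamma> \<delta> where "\<gamma>' = \<gamma> @ [\<epsilon>]" "\<gamma> \<in> growth_seqs \<alpha> \<delta>"
    "a = 1 \<Longrightarrow> \<epsilon> = \<delta> @ [1]" "a = -1 \<Longrightarrow> \<exists>j. plus_paired \<delta> j \<epsilon>"
proof -
  note last = growth_seqs_last[OF \<gamma>']
  define \<gamma> where "\<gamma> = butlast \<gamma>'"
  have len: "length \<gamma> = Suc (length \<alpha>)" using last by (simp add: \<gamma>_def)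
  have "\<gamma>' \<noteq> []" using last(1) by auto
  then have split: "\<gamma>' = \<gamma> @ [\<epsilon>]"
    using last(1,2) append_butlast_last_id[of \<gamma>'] last_conv_nth[of \<gamma>'] by (simp add: \<gamma>_def)
  have nth: "\<gamma>' ! k = \<gamma> ! k" if "k \<le> length \<alpha>" for k
    using that len by (simp add: split nth_append)
  have step: "(\<alpha> @ [a]) ! k = 1 \<longrightarrow> \<gamma>' ! Suc k = (\<gamma>' ! k) @ [1]"
    "(\<alpha> @ [a]) ! k = -1 \<longrightarrow> (\<exists>j. plus_paired (\<gamma>' ! k) j (\<gamma>' ! Suc k))"
    if "k \<le> length \<alpha>" for k
    using \<gamma>' that by (auto simp: growth_seqs_def)
  have fac: "one_factor (\<gamma>' ! k) \<and> length (\<gamma>' ! k) = k" if "k \<le> length \<alpha>" for k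
    using \<gamma>' that by (auto simp: growth_seqs_def)
  show thesis
  proof
    show "\<gamma>' = \<gamma> @ [\<epsilon>]" by (rule split)
    show "\<gamma> \<in> growth_seqs \<alpha> (\<gamma> ! length \<alpha>)"
      unfolding growth_seqs_def mem_Collect_eq
    proof (intro conjI allI impI)
      fix k assume k: "k < length \<alpha>"
      show "\<gamma> ! Suc k = \<gamma> ! k @ [1]" if "\<alpha> ! k = 1"
        using step(1)[of k] nth[of k] nth[of "Suc k"] that k by (simp add: nth_append)
      show "\<exists>j. plus_paired (\<gamma> ! k) j (\<gamma> ! Suc k)" if "\<alpha> ! k = -1"
        using step(2)[of k] nth[of k] nth[of "Suc k"] that k by (simp add: nth_append)
    qed (use fac nth len in auto)
    show "\<epsilon> = \<gamma> ! length \<alpha> @ [1]" if "a = 1"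
      using step(1)[of "length \<alpha>"] that nth[of "length \<alpha>"] last by simp
    show "\<exists>j. plus_paired (\<gamma> ! length \<alpha>) j \<epsilon>" if "a = -1"
      using step(2)[of "length \<alpha>"] that nth[of "length \<alpha>"] last by simp
  qed
qed

text \<open>
  The recursion for \<open>pi2\<close> sums only over predecessors of the right weight; this is what makes that
  restriction automatic for the terms of a sequence.
\<close>

lemma growth_seqs_weight:
  assumes "set \<alpha> \<subseteq> {1, -1}" and "\<gamma> \<in> growth_seqs \<alpha> \<epsilon>"
  shows "weight \<epsilon> = weight \<alpha>"
  using assms
proof (induction \<alpha> arbitrary: \<gamma> \<epsilon> rule: rev_induct)
  case Nil
  then show ?case by (auto simp: growth_seqs_def)
next
  case (snoc a \<alpha>)
  obtain \<gamma>0 \<delta> where *: "\<gamma>0 \<in> growth_seqs \<alpha> \<delta>"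
    "a = 1 \<Longrightarrow> \<epsilon> = \<delta> @ [1]" "a = -1 \<Longrightarrow> \<exists>j. plus_paired \<delta> j \<epsilon>"
    using growth_seqs_snocE[OF snoc.prems(2)] by metis
  have IH: "weight \<delta> = weight \<alpha>" using snoc *(1) by simp
  have "a = 1 \<or> a = -1" using snoc.prems(1) by auto
  then show ?case
  proof
    assume "a = 1"
    then show ?thesis using *(2) IH by (simp add: weight_def)
  next
    assume "a = -1"
    then show ?thesis
      using *(3) IH weight_plus_paired[OF growth_seqs_last(3)[OF *(1)]]
      by (auto simp: weight_def)
  qed
qed

lemma growth_seqs_contained:
  assumes "set \<alpha> \<subseteq> {1, -1}" and "\<gamma> \<in> growth_seqs \<alpha> \<epsilon>" and "k \<le> length \<alpha>"
  shows "contained (\<gamma> ! k) \<epsilon>"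
  using assms
proof (induction \<alpha> arbitrary: \<gamma> \<epsilon> rule: rev_induct)
  case Nil
  then show ?case by (auto simp: growth_seqs_def contained_refl)
next
  case (snoc a \<alpha>)
  obtain \<gamma>0 \<delta> where *: "\<gamma> = \<gamma>0 @ [\<epsilon>]" "\<gamma>0 \<in> growth_seqs \<alpha> \<delta>"
    "a = 1 \<Longrightarrow> \<epsilon> = \<delta> @ [1]" "a = -1 \<Longrightarrow> \<exists>j. plus_paired \<delta> j \<epsilon>"
    using growth_seqs_snocE[OF snoc.prems(2)] by metis
  note last = growth_seqs_last[OF *(2)]
  have "a = 1 \<or> a = -1" using snoc.prems(1) by auto
  then have step: "contained \<delta> \<epsilon>"
    using *(3,4) contained_append contained_plus_paired[OF last(3)] by blast
  show ?case
  proof (cases "k \<le> length \<alpha>")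
    case True
    then have "contained (\<gamma>0 ! k) \<delta>" using snoc *(2) by simp
    then show ?thesis using True last step contained_trans by (auto simp: *(1) nth_append)
  next
    case False
    then have "\<gamma> ! k = \<epsilon>" using snoc.prems(3) last by (simp add: *(1) nth_append)
    then show ?thesis by (simp add: contained_refl)
  qed
qed

lemma diamond_seqs_eq_growth_seqs:
  assumes pm: "set \<alpha> \<subseteq> {1, -1}" and \<beta>: "one_factor \<beta>"
    and w: "weight \<beta> = weight \<alpha>" and len: "length \<beta> = length \<alpha>"
  shows "diamond_seqs \<alpha> \<beta> = growth_seqs \<alpha> \<beta>"
proof (intro equalityI subsetI)
  fix \<gamma> assume \<gamma>: "\<gamma> \<in> diamond_seqs \<alpha> \<beta>"
  let ?\<epsilon> = "\<gamma> ! length \<alpha>"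
  have g: "\<gamma> \<in> growth_seqs \<alpha> ?\<epsilon>" using \<gamma> by (simp add: growth_seqs_def diamond_seqs_def)
  have "?\<epsilon> = \<beta>"
    using growth_seqs_last[OF g] growth_seqs_weight[OF pm g] \<gamma> \<beta> w len
    by (intro contained_imp_eq) (auto simp: diamond_seqs_def)
  with g show "\<gamma> \<in> growth_seqs \<alpha> \<beta>" by simp
next
  fix \<gamma> assume \<gamma>: "\<gamma> \<in> growth_seqs \<alpha> \<beta>"
  then show "\<gamma> \<in> diamond_seqs \<alpha> \<beta>"
    using growth_seqs_contained[OF pm \<gamma>] by (simp add: growth_seqs_def diamond_seqs_def)
qed


section \<open>Unrolling the recursion\<close>

lemma pairing_monomial_prefix:
  assumes "length \<gamma> = Suc (length \<alpha>)"
  shows "(\<Prod>k\<in>{k. k < length \<alpha> \<and> (\<alpha> @ [a]) ! k = -1}. pairing_var (\<gamma> @ [\<epsilon>]) k)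
    = pairing_monomial \<alpha> \<gamma>"
  unfolding pairing_monomial_def
  by (rule prod.cong) (use assms in \<open>auto simp: nth_append pairing_var_def\<close>)

lemma pairing_monomial_snoc_plus:
  assumes "length \<gamma> = Suc (length \<alpha>)"
  shows "pairing_monomial (\<alpha> @ [1]) (\<gamma> @ [\<epsilon>]) = pairing_monomial \<alpha> \<gamma>"
proof -
  have "{k. k < length (\<alpha> @ [1]) \<and> (\<alpha> @ [1]) ! k = -1}
      = {k. k < length \<alpha> \<and> (\<alpha> @ [1]) ! k = -1}"
    by (auto simp: less_Suc_eq)
  then show ?thesis
    using pairing_monomial_prefix[OF assms, where a = 1 and \<epsilon> = \<epsilon>] by (simp only: pairing_monomial_def)
qed

lemma pairing_monomial_snoc_minus:
  assumes \<gamma>: "\<gamma> \<in> growth_seqs \<alpha> \<delta>" and pp: "plus_paired \<delta> j \<epsilon>"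
  shows "pairing_monomial (\<alpha> @ [-1]) (\<gamma> @ [\<epsilon>]) = tvar j * pairing_monomial \<alpha> \<gamma>"
proof -
  note last = growth_seqs_last[OF \<gamma>]
  have set: "{k. k < length (\<alpha> @ [-1]) \<and> (\<alpha> @ [-1]) ! k = -1}
      = insert (length \<alpha>) {k. k < length \<alpha> \<and> (\<alpha> @ [-1]) ! k = -1}"
    by (auto simp: less_Suc_eq)
  have "(THE j. plus_paired \<delta> j \<epsilon>) = j"
    using pp plus_paired_unique[OF last(3)] by blast
  then have "pairing_var (\<gamma> @ [\<epsilon>]) (length \<alpha>) = tvar j"
    using last by (simp add: pairing_var_def nth_append)
  moreover have "pairing_monomial (\<alpha> @ [-1]) (\<gamma> @ [\<epsilon>])
      = pairing_var (\<gamma> @ [\<epsilon>]) (length \<alpha>)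
        * (\<Prod>k\<in>{k. k < length \<alpha> \<and> (\<alpha> @ [-1]) ! k = -1}. pairing_var (\<gamma> @ [\<epsilon>]) k)"
    unfolding pairing_monomial_def set by (subst prod.insert) auto
  ultimately show ?thesis using pairing_monomial_prefix[OF last(1), where a = "-1" and \<epsilon> = \<epsilon>] by simp
qed

lemma finite_growth_seqs: "finite (growth_seqs \<alpha> \<epsilon>)"
proof (rule finite_subset)
  let ?L = "{x :: int list. set x \<subseteq> {1, -1} \<and> length x \<le> length \<alpha>}"
  show "growth_seqs \<alpha> \<epsilon> \<subseteq> {\<gamma>. set \<gamma> \<subseteq> ?L \<and> length \<gamma> = Suc (length \<alpha>)}"
    by (fastforce simp: growth_seqs_def one_factor_def in_set_conv_nth less_Suc_eq_le)
  show "finite {\<gamma>. set \<gamma> \<subseteq> ?L \<and> length \<gamma> = Suc (length \<alpha>)}"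
    by (intro finite_lists_length_eq finite_lists_length_le) auto
qed

theorem pi2_eq_sum_growth_seqs:
  assumes "set \<alpha> \<subseteq> {1, -1}" and "one_factor \<epsilon>" and "length \<epsilon> = length \<alpha>"
  shows "pi2 \<alpha> \<epsilon> = (\<Sum>\<gamma>\<in>growth_seqs \<alpha> \<epsilon>. pairing_monomial \<alpha> \<gamma>)"
  using assms
proof (induction \<alpha> arbitrary: \<epsilon> rule: rev_induct)
  case Nil
  then show ?case by (simp add: pi2_Nil growth_seqs_Nil pairing_monomial_def)
next
  case (snoc a \<alpha>)
  have pm: "set \<alpha> \<subseteq> {1, -1}" and "a = 1 \<or> a = -1" using snoc.prems(1) by auto
  then consider (plus) \<beta> where "a = 1" "\<epsilon> = \<beta> @ [1]"
    | (zero) "a = 1" "\<And>\<beta>. \<epsilon> \<noteq> \<beta> @ [1]" | (minus) "a = -1" by blast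
  then show ?case
  proof cases
    case plus
    have "(\<Sum>\<gamma>\<in>growth_seqs \<alpha> \<beta>. pairing_monomial \<alpha> \<gamma>)
        = (\<Sum>\<gamma>'\<in>growth_seqs (\<alpha> @ [1]) \<epsilon>. pairing_monomial (\<alpha> @ [1]) \<gamma>')"
    proof (rule sum.reindex_bij_witness[where i = butlast and j = "\<lambda>\<gamma>. \<gamma> @ [\<epsilon>]"])
      fix \<gamma> assume \<gamma>: "\<gamma> \<in> growth_seqs \<alpha> \<beta>"
      show "butlast (\<gamma> @ [\<epsilon>]) = \<gamma>" by simp
      show "\<gamma> @ [\<epsilon>] \<in> growth_seqs (\<alpha> @ [1]) \<epsilon>"
        using snoc.prems plus by (intro growth_seqs_snocI[OF \<gamma>]) auto
      show "pairing_monomial (\<alpha> @ [1]) (\<gamma> @ [\<epsilon>]) = pairing_monomial \<alpha> \<gamma>"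
        by (rule pairing_monomial_snoc_plus) (rule growth_seqs_last(1)[OF \<gamma>])
    next
      fix \<gamma>' assume "\<gamma>' \<in> growth_seqs (\<alpha> @ [1]) \<epsilon>"
      then obtain \<gamma> \<delta> where *: "\<gamma>' = \<gamma> @ [\<epsilon>]" "\<gamma> \<in> growth_seqs \<alpha> \<delta>" "\<epsilon> = \<delta> @ [1]"
        by (rule growth_seqs_snocE) simp
      then show "butlast \<gamma>' @ [\<epsilon>] = \<gamma>'" "butlast \<gamma>' \<in> growth_seqs \<alpha> \<beta>"
        using plus by auto
    qed
    moreover have "pi2 \<alpha> \<beta> = (\<Sum>\<gamma>\<in>growth_seqs \<alpha> \<beta>. pairing_monomial \<alpha> \<gamma>)"
      using snoc plus one_factor_butlast by (intro snoc.IH pm) auto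
    ultimately show ?thesis by (simp add: plus pi2_plus)
  next
    case zero
    then have "growth_seqs (\<alpha> @ [a]) \<epsilon> = {}" by (auto elim: growth_seqs_snocE)
    then show ?thesis using zero by (simp add: pi2_plus_0)
  next
    case minus
    let ?P = "predecessors \<alpha> \<epsilon>"
    let ?S = "SIGMA x:?P. growth_seqs \<alpha> (fst x)"
    have "pi2 (\<alpha> @ [-1]) \<epsilon> = (\<Sum>x\<in>?P. tvar (snd x) * pi2 \<alpha> (fst x))"
      by (simp add: pi2_minus case_prod_beta)
    also have "\<dots> = (\<Sum>x\<in>?P. \<Sum>\<gamma>\<in>growth_seqs \<alpha> (fst x). tvar (snd x) * pairing_monomial \<alpha> \<gamma>)"
      using snoc.IH[OF pm] by (intro sum.cong) (auto simp: predecessors_def sum_distrib_left)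
    also have "\<dots> = (\<Sum>(x, \<gamma>)\<in>?S. tvar (snd x) * pairing_monomial \<alpha> \<gamma>)"
      by (rule sum.Sigma) (auto simp: finite_predecessors finite_growth_seqs)
    also have "\<dots> = (\<Sum>\<gamma>'\<in>growth_seqs (\<alpha> @ [-1]) \<epsilon>. pairing_monomial (\<alpha> @ [-1]) \<gamma>')"
    \<comment> \<open>A sequence ending in \<open>\<epsilon>\<close> remembers both the predecessor and the variable used in the last
      step: the former is its last term but one, and the latter is unique.\<close>
    proof (rule sum.reindex_bij_witness[where j = "\<lambda>(x, \<gamma>). \<gamma> @ [\<epsilon>]" and
          i = "\<lambda>\<gamma>'. ((\<gamma>' ! length \<alpha>, THE j. plus_paired (\<gamma>' ! length \<alpha>) j \<epsilon>), butlast \<gamma>')"])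
      fix z assume z: "z \<in> ?S"
      then obtain \<delta> j \<gamma> where z_eq: "z = ((\<delta>, j), \<gamma>)" by (metis surj_pair)
      have \<gamma>: "\<gamma> \<in> growth_seqs \<alpha> \<delta>" and pp: "plus_paired \<delta> j \<epsilon>"
        using z by (auto simp: z_eq predecessors_def)
      note last = growth_seqs_last[OF \<gamma>]
      have "(THE j. plus_paired \<delta> j \<epsilon>) = j" using pp plus_paired_unique[OF last(3)] by blast
      then show "(\<lambda>\<gamma>'. ((\<gamma>' ! length \<alpha>, THE j. plus_paired (\<gamma>' ! length \<alpha>) j \<epsilon>), butlast \<gamma>'))
          (case z of (x, \<gamma>) \<Rightarrow> \<gamma> @ [\<epsilon>]) = z"
        using last by (simp add: z_eq nth_append)
      show "(case z of (x, \<gamma>) \<Rightarrow> \<gamma> @ [\<epsilon>]) \<in> growth_seqs (\<alpha> @ [-1]) \<epsilon>"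
        using snoc.prems pp by (auto simp: z_eq intro!: growth_seqs_snocI[OF \<gamma>])
      show "pairing_monomial (\<alpha> @ [-1]) (case z of (x, \<gamma>) \<Rightarrow> \<gamma> @ [\<epsilon>])
          = (case z of (x, \<gamma>) \<Rightarrow> tvar (snd x) * pairing_monomial \<alpha> \<gamma>)"
        by (simp add: z_eq pairing_monomial_snoc_minus[OF \<gamma> pp])
    next
      fix \<gamma>' assume "\<gamma>' \<in> growth_seqs (\<alpha> @ [-1]) \<epsilon>"
      then obtain \<gamma> \<delta> j where split: "\<gamma>' = \<gamma> @ [\<epsilon>]" and \<gamma>: "\<gamma> \<in> growth_seqs \<alpha> \<delta>"
        and pp: "plus_paired \<delta> j \<epsilon>"
        by (rule growth_seqs_snocE) auto
      note last = growth_seqs_last[OF \<gamma>]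
      have "(THE j. plus_paired \<delta> j \<epsilon>) = j" using pp plus_paired_unique[OF last(3)] by blast
      moreover have "(\<delta>, j) \<in> ?P"
        using last growth_seqs_weight[OF pm \<gamma>] pp by (simp add: predecessors_def)
      ultimately show "((\<gamma>' ! length \<alpha>, THE j. plus_paired (\<gamma>' ! length \<alpha>) j \<epsilon>), butlast \<gamma>') \<in> ?S"
        using last \<gamma> by (simp add: split nth_append)
      show "(case ((\<gamma>' ! length \<alpha>, THE j. plus_paired (\<gamma>' ! length \<alpha>) j \<epsilon>), butlast \<gamma>') of
          (x, \<gamma>) \<Rightarrow> \<gamma> @ [\<epsilon>]) = \<gamma>'"
        by (simp add: split)
    qed
    finally show ?thesis by (simp add: minus)
  qed
qed

theorem corollary4p13:
  fixes v :: "'k::field" and n :: nat and \<alpha> \<beta> :: "int list"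
  assumes "v \<noteq> 0" and "qfact v n \<noteq> 0"
    and "one_factor \<alpha>" and "one_factor \<beta>"
    and "weight \<beta> = weight \<alpha>" and "length \<beta> = length \<alpha>" and "length \<alpha> \<le> n"
    and "dominated \<beta> \<alpha>"
  shows "pi2 \<alpha> \<beta> = (\<Sum>\<gamma>\<in>diamond_seqs \<alpha> \<beta>. pairing_monomial \<alpha> \<gamma>)"
proof -
  have pm: "set \<alpha> \<subseteq> {1, -1}" by (rule one_factor_pm_one) fact
  have "diamond_seqs \<alpha> \<beta> = growth_seqs \<alpha> \<beta>"
    by (rule diamond_seqs_eq_growth_seqs[OF pm]) fact+
  moreover have "pi2 \<alpha> \<beta> = (\<Sum>\<gamma>\<in>growth_seqs \<alpha> \<beta>. pairing_monomial \<alpha> \<gamma>)"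
    by (rule pi2_eq_sum_growth_seqs[OF pm]) fact+
  ultimately show ?thesis by simp
qed

end
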